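(* Let $L$ be either $\mathbf{IL}^-(\mathbf{J2}_+,\mathbf{J5})$ or $\mathbf{IL}=\mathbf{IL}^-(\mathbf{J1},\mathbf{J2},\mathbf{J5})$. Then for every formula $A$ the following are equivalent: (1) $L\vdash A$; (2) $A$ is valid in every $\mathbf{IL}^-$-frame in which all axioms of $L$ are valid; (3) $A$ is valid in every finite $\mathbf{IL}^-$-frame in which all axioms of $L$ are valid.
   Context: Formulas are built from countably many propositional variables, $\top,\bot$, the connectives $\neg,\land,\lor,\to$, a unary modal operator $\Box$ and a binary modal operator $\rhd$; $\Diamond A$ abbreviates $\neg\Box\neg A$. The logic $\mathbf{IL}^-$ has as axioms all tautologies, $\Box(A\to B)\to(\Box A\to\Box B)$, $\Box(\Box A\to A)\to\Box A$, $\mathbf{J3}$: $(A\rhd C)\land(B\rhd C)\to(A\lor B)\rhd C$, and $\mathbf{J6}$: $\Box A\leftrightarrow(\neg A)\rhd\bot$; its rules are modus ponens, necessitation, $\mathbf{R1}$ (from $A\to B$ infer $C\rhd A\to C\rhd B$) and $\mathbf{R2}$ (from $A\to B$ infer $B\rhd C\to A\rhd C$). $\mathbf{IL}^-(\Sigma_1,\dots,\Sigma_n)$ denotes $\mathbf{IL}^-$ with the schemata $\Sigma_i$ added as axioms. Schemata: $\mathbf{J1}$: $\Box(A\to B)\to A\rhd B$; $\mathbf{J2}$: $(A\rhd B)\land(B\rhd C)\to A\rhd C$; $\mathbf{J2}_+$: $(A\rhd(B\lor C))\land(B\rhd C)\to A\rhd C$; $\mathbf{J5}$: $\Diamond A\rhd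 A$. An $\mathbf{IL}^-$-frame is a triple $\langle W,R,\{S_x\}_{x\in W}\rangle$ with $W$ nonempty, $R$ transitive and conversely well-founded on $W$, and each $S_x$ a binary relation on $W$ with $yS_xz\Rightarrow xRy$. Satisfaction: Boolean clauses as usual, $x\Vdash\Box A$ iff $y\Vdash A$ for all $y$ with $xRy$, and $x\Vdash A\rhd B$ iff for every $y$ with $xRy$ and $y\Vdash A$ there is $z$ with $yS_xz$ and $z\Vdash B$. A formula is valid in a frame if it holds at every point under every satisfaction relation; a schema is valid if all instances are. *)

theory Defs
  imports Main
begin

datatype formula =
    Var nat
  | Top ("\<^bold>\<top>")
  | Bot ("\<^bold>\<bottom>")
  | Neg formula ("\<^bold>\<not> _" [60] 60)
  | Conj formula formula (infixr "\<^bold>\<and>" 35)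
  | Disj formula formula (infixr "\<^bold>\<or>" 30)
  | Imp formula formula (infixr "\<^bold>\<rightarrow>" 25)
  | Box formula ("\<^bold>\<box> _" [60] 60)
  | Rhd formula formula (infix "\<^bold>\<rhd>" 55)

abbreviation Dia :: "formula \<Rightarrow> formula" ("\<^bold>\<diamond> _" [60] 60) where
  "\<^bold>\<diamond> A \<equiv> \<^bold>\<not> \<^bold>\<box> \<^bold>\<not> A"

abbreviation Iff :: "formula \<Rightarrow> formula \<Rightarrow> formula" (infixr "\<^bold>\<leftrightarrow>" 24) where
  "A \<^bold>\<leftrightarrow> B \<equiv> (A \<^bold>\<rightarrow> B) \<^bold>\<and> (B \<^bold>\<rightarrow> A)"

(* Propositional evaluation: variables and formulas with an outermost modal operator are
   assigned arbitrary truth values. *)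
primrec prop_eval :: "(formula \<Rightarrow> bool) \<Rightarrow> formula \<Rightarrow> bool" where
  "prop_eval v (Var p) = v (Var p)"
| "prop_eval v \<^bold>\<top> = True"
| "prop_eval v \<^bold>\<bottom> = False"
| "prop_eval v (\<^bold>\<not> A) = (\<not> prop_eval v A)"
| "prop_eval v (A \<^bold>\<and> B) = (prop_eval v A \<and> prop_eval v B)"
| "prop_eval v (A \<^bold>\<or> B) = (prop_eval v A \<or> prop_eval v B)"
| "prop_eval v (A \<^bold>\<rightarrow> B) = (prop_eval v A \<longrightarrow> prop_eval v B)"
| "prop_eval v (\<^bold>\<box> A) = v (\<^bold>\<box> A)"
| "prop_eval v (A \<^bold>\<rhd> B) = v (A \<^bold>\<rhd> B)"

definition tautology :: "formula \<Rightarrow> bool" where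
  "tautology A \<longleftrightarrow> (\<forall>v. prop_eval v A)"

(* A schema is the set of its instances. *)
type_synonym schema = "formula set"

definition Taut :: schema where
  "Taut = {A. tautology A}"

definition K :: schema where
  "K = {\<^bold>\<box> (A \<^bold>\<rightarrow> B) \<^bold>\<rightarrow> (\<^bold>\<box> A \<^bold>\<rightarrow> \<^bold>\<box> B) |A B. True}"

definition Loeb :: schema where
  "Loeb = {\<^bold>\<box> (\<^bold>\<box> A \<^bold>\<rightarrow> A) \<^bold>\<rightarrow> \<^bold>\<box> A |A. True}"

definition J1 :: schema where
  "J1 = {\<^bold>\<box> (A \<^bold>\<rightarrow> B) \<^bold>\<rightarrow> (A \<^bold>\<rhd> B) |A B. True}"

definition J2 :: schema where
  "J2 = {((A \<^bold>\<rhd> B) \<^bold>\<and> (B \<^bold>\<rhd> C)) \<^bold>\<rightarrow> (A \<^bold>\<rhd> C) |A B C. True}"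

definition J2_plus :: schema where
  "J2_plus = {((A \<^bold>\<rhd> (B \<^bold>\<or> C)) \<^bold>\<and> (B \<^bold>\<rhd> C)) \<^bold>\<rightarrow> (A \<^bold>\<rhd> C) |A B C. True}"

definition J3 :: schema where
  "J3 = {((A \<^bold>\<rhd> C) \<^bold>\<and> (B \<^bold>\<rhd> C)) \<^bold>\<rightarrow> ((A \<^bold>\<or> B) \<^bold>\<rhd> C) |A B C. True}"

definition J5 :: schema where
  "J5 = {(\<^bold>\<diamond> A) \<^bold>\<rhd> A |A. True}"

definition J6 :: schema where
  "J6 = {\<^bold>\<box> A \<^bold>\<leftrightarrow> ((\<^bold>\<not> A) \<^bold>\<rhd> \<^bold>\<bottom>) |A. True}"

(* All logics considered share the same rules, so a logic is represented by its set of axioms;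
   "IL_minus Sigmas" is IL^- extended by the schemata in Sigmas. *)
definition IL_minus :: "schema set \<Rightarrow> formula set" where
  "IL_minus \<Sigma>s = Taut \<union> K \<union> Loeb \<union> J3 \<union> J6 \<union> \<Union>\<Sigma>s"

definition IL :: "formula set" where
  "IL = IL_minus {J1, J2, J5}"

inductive derivable :: "formula set \<Rightarrow> formula \<Rightarrow> bool" (infix "\<turnstile>" 50) for L where
  axiom: "A \<in> L \<Longrightarrow> L \<turnstile> A"
| modus_ponens: "L \<turnstile> (A \<^bold>\<rightarrow> B) \<Longrightarrow> L \<turnstile> A \<Longrightarrow> L \<turnstile> B"
| necessitation: "L \<turnstile> A \<Longrightarrow> L \<turnstile> (\<^bold>\<box> A)"
| R1: "L \<turnstile> (A \<^bold>\<rightarrow> B) \<Longrightarrow> L \<turnstile> ((C \<^bold>\<rhd> A) \<^bold>\<rightarrow> (C \<^bold>\<rhd> B))"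
| R2: "L \<turnstile> (A \<^bold>\<rightarrow> B) \<Longrightarrow> L \<turnstile> ((B \<^bold>\<rhd> C) \<^bold>\<rightarrow> (A \<^bold>\<rhd> C))"

record 'w frame =
  worlds :: "'w set"
  acc :: "('w \<times> 'w) set"
  succ_rel :: "'w \<Rightarrow> ('w \<times> 'w) set"

(* Only the relations "succ_rel F x" with x in "worlds F" belong to the frame; the values
   at other points of the type are unconstrained and never used. *)
definition IL_minus_frame :: "'w frame \<Rightarrow> bool" where
  "IL_minus_frame F \<longleftrightarrow>
     worlds F \<noteq> {} \<and>
     acc F \<subseteq> worlds F \<times> worlds F \<and> trans (acc F) \<and> wf ((acc F)\<inverse>) \<and>
     (\<forall>x\<in>worlds F. succ_rel F x \<subseteq> worlds F \<times> worlds F \<and>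
        (\<forall>y z. (y, z) \<in> succ_rel F x \<longrightarrow> (x, y) \<in> acc F))"

(* A satisfaction relation on a frame is determined by its restriction to the variables,
   here the valuation V. *)
primrec sat :: "'w frame \<Rightarrow> ('w \<Rightarrow> nat \<Rightarrow> bool) \<Rightarrow> 'w \<Rightarrow> formula \<Rightarrow> bool" where
  "sat F V x (Var p) = V x p"
| "sat F V x \<^bold>\<top> = True"
| "sat F V x \<^bold>\<bottom> = False"
| "sat F V x (\<^bold>\<not> A) = (\<not> sat F V x A)"
| "sat F V x (A \<^bold>\<and> B) = (sat F V x A \<and> sat F V x B)"
| "sat F V x (A \<^bold>\<or> B) = (sat F V x A \<or> sat F V x B)"
| "sat F V x (A \<^bold>\<rightarrow> B) = (sat F V x A \<longrightarrow> sat F V x B)"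
| "sat F V x (\<^bold>\<box> A) = (\<forall>y. (x, y) \<in> acc F \<longrightarrow> sat F V y A)"
| "sat F V x (A \<^bold>\<rhd> B) =
     (\<forall>y. (x, y) \<in> acc F \<and> sat F V y A \<longrightarrow> (\<exists>z. (y, z) \<in> succ_rel F x \<and> sat F V z B))"

definition valid :: "'w frame \<Rightarrow> formula \<Rightarrow> bool" where
  "valid F A \<longleftrightarrow> (\<forall>V. \<forall>x\<in>worlds F. sat F V x A)"

definition frame_of :: "'w frame \<Rightarrow> formula set \<Rightarrow> bool" where
  "frame_of F L \<longleftrightarrow> IL_minus_frame F \<and> (\<forall>B\<in>L. valid F B)"

end

theory Submission
  imports Defs
begin

text \<open>Since \<open>IL\<close> derives \<open>J2_plus\<close>, it suffices to build one finite countermodel for every logic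
  deriving \<open>J2_plus\<close> and \<open>J5\<close>, whose frame also validates \<open>J1\<close> when the logic derives \<open>J1\<close>. Following
  de Jongh and Veltman, a world is a maximal consistent set \<open>\<Gamma>\<close> with a list \<open>\<tau>\<close> of labels.
  A label \<open>C\<close> appended to \<open>\<tau>\<close> announces that the successor may have been chosen \<open>C\<close>-critical, that
  is, to refute \<open>B\<close> and \<open>\<diamond>B\<close> for all \<open>B \<rhd> C\<close> in \<open>\<Gamma>\<close>; the relation \<open>S\<close> of \<open>\<Gamma>\<close> preserves the
  label and leads from a \<open>C\<close>-critical world to \<open>C\<close>-critical worlds that refute \<open>C\<close>. Reflexivity of \<open>S\<close> is
  not imposed: it holds automatically once \<open>C \<rhd> C\<close> is derivable. \<open>J2_plus\<close> is what provides
  \<open>S\<close>-successors refuting the label.\<close>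

section \<open>Soundness\<close>

text \<open>Satisfaction at a point is itself a propositional evaluation in which modal formulas
  count as atoms. This is what makes tautologies valid.\<close>

lemma prop_eval_sat: "prop_eval (sat F V x) A = sat F V x A"
  by (induction A) auto

text \<open>Induction along the converse of R: by transitivity every successor of \<open>y\<close>
  is a successor of \<open>x\<close>, so the induction hypothesis yields \<open>\<box> A\<close> at
  \<open>y\<close>, and the premise at \<open>y\<close> then yields \<open>A\<close>.\<close>

lemma sat_Loeb:
  assumes "IL_minus_frame F"
  shows "sat F V x (\<^bold>\<box> (\<^bold>\<box> A \<^bold>\<rightarrow> A) \<^bold>\<rightarrow> \<^bold>\<box> A)"
proof -
  have wf: "wf ((acc F)\<inverse>)" and tr: "trans (acc F)"
    using assms by (auto simp: IL_minus_frame_def)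
  have "sat F V y A" if "(x, y) \<in> acc F" "sat F V x (\<^bold>\<box> (\<^bold>\<box> A \<^bold>\<rightarrow> A))" for y
    using wf that(1)
  proof (induction y rule: wf_induct_rule)
    case (less y)
    then show ?case
      using that(2) tr by (auto dest: transD)
  qed
  then show ?thesis
    by simp
qed

lemma IL_minus_valid:
  assumes "IL_minus_frame F" "A \<in> IL_minus {}"
  shows "valid F A"
proof -
  consider "A \<in> Taut" | "A \<in> K" | "A \<in> Loeb" | "A \<in> J3" | "A \<in> J6"
    using assms(2) by (auto simp: IL_minus_def)
  then show ?thesis
  proof cases
    case 1
    then show ?thesis
      by (simp add: Taut_def tautology_def valid_def flip: prop_eval_sat)
  next
    case 3
    then show ?thesis
      using sat_Loeb [OF assms(1)] unfolding Loeb_def valid_def by blast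
  qed (auto simp: K_def J3_def J6_def valid_def)
qed

lemma soundness:
  assumes "L \<turnstile> A" "frame_of F L"
  shows "valid F A"
proof -
  \<comment> \<open>Validity speaks only of points in \<open>worlds F\<close>, so premises of rules
    can be applied at a successor only once it is known to be a world.\<close>
  have acc: "y \<in> worlds F" if "(x, y) \<in> acc F" for x y
    using assms(2) that by (auto simp: frame_of_def IL_minus_frame_def)
  have succ_rel: "z \<in> worlds F" if "x \<in> worlds F" "(y, z) \<in> succ_rel F x" for x y z
    using assms(2) that by (auto simp: frame_of_def IL_minus_frame_def)
  show ?thesis
    using assms(1)
  proof induction
    case (axiom A)
    then show ?case
      using assms(2) by (auto simp: frame_of_def)
  next
    case (necessitation A)
    then have "sat F V x (\<^bold>\<box> A)" if "x \<in> worlds F" for V x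
      using acc by (auto simp: valid_def)
    then show ?case
      by (simp add: valid_def del: sat.simps)
  next
    case (R1 A B C)
    then have imp: "sat F V z A \<Longrightarrow> sat F V z B" if "z \<in> worlds F" for V z
      using that by (simp add: valid_def)
    have "sat F V x (C \<^bold>\<rhd> B)" if x: "x \<in> worlds F" and CA: "sat F V x (C \<^bold>\<rhd> A)" for V x
      unfolding sat.simps
    proof (intro allI impI)
      fix y
      assume "(x, y) \<in> acc F \<and> sat F V y C"
      then obtain z where "(y, z) \<in> succ_rel F x" "sat F V z A"
        using CA by auto
      then show "\<exists>z. (y, z) \<in> succ_rel F x \<and> sat F V z B"
        using imp succ_rel x by blast
    qed
    then show ?case
      by (simp add: valid_def del: sat.simps(9))
  next
    case (R2 A B C)
    then have imp: "sat F V z A \<Longrightarrow> sat F V z B" if "z \<in> worlds F" for V z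
      using that by (simp add: valid_def)
    have "sat F V x (A \<^bold>\<rhd> C)" if "x \<in> worlds F" "sat F V x (B \<^bold>\<rhd> C)" for V x
      unfolding sat.simps
    proof (intro allI impI)
      fix y
      assume "(x, y) \<in> acc F \<and> sat F V y A"
      then show "\<exists>z. (y, z) \<in> succ_rel F x \<and> sat F V z C"
        using that(2) imp acc by auto
    qed
    then show ?case
      by (simp add: valid_def del: sat.simps(9))
  qed (auto simp: valid_def)
qed

section \<open>Frames of the two logics\<close>

text \<open>For \<open>J2_plus\<close>, an \<open>S\<close>-successor of \<open>y\<close> satisfying
  only the left disjunct is again an R-successor of \<open>x\<close>; the second conjunct applies
  there, and transitivity composes the two \<open>S\<close>-steps. \<open>J5\<close> holds because
  an R-step above \<open>x\<close> is also an \<open>S\<close>-step.\<close>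

lemma frame_of_J2_plus_J5:
  assumes "IL_minus_frame F"
    and "\<And>x. x \<in> worlds F \<Longrightarrow> trans (succ_rel F x)"
    and "\<And>x y z. x \<in> worlds F \<Longrightarrow> (y, z) \<in> succ_rel F x \<Longrightarrow> (x, z) \<in> acc F"
    and "\<And>x y z. (x, y) \<in> acc F \<Longrightarrow> (y, z) \<in> acc F \<Longrightarrow> (y, z) \<in> succ_rel F x"
  shows "frame_of F (IL_minus {J2_plus, J5})"
proof -
  have "valid F A" if A: "A \<in> J2_plus" for A
    unfolding valid_def
  proof (intro allI ballI)
    fix V x
    assume x: "x \<in> worlds F"
    obtain B C D where A_eq: "A = (((B \<^bold>\<rhd> (C \<^bold>\<or> D)) \<^bold>\<and> (C \<^bold>\<rhd> D)) \<^bold>\<rightarrow> (B \<^bold>\<rhd> D))"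
      using A by (auto simp: J2_plus_def)
    have "\<exists>z. (y, z) \<in> succ_rel F x \<and> sat F V z D"
      if BCD: "sat F V x (B \<^bold>\<rhd> (C \<^bold>\<or> D))" and CD: "sat F V x (C \<^bold>\<rhd> D)"
        and y: "(x, y) \<in> acc F" "sat F V y B" for y
    proof -
      obtain z where z: "(y, z) \<in> succ_rel F x" "sat F V z C \<or> sat F V z D"
        using BCD y by auto
      show ?thesis
      proof (cases "sat F V z D")
        case False
        have "(x, z) \<in> acc F"
          using assms(3) x z(1) by blast
        then obtain z' where "(z, z') \<in> succ_rel F x" "sat F V z' D"
          using CD z(2) False by auto
        then show ?thesis
          using z(1) assms(2) [OF x] by (blast dest: transD)
      qed (use z(1) in blast)
    qed
    then have "sat F V x (B \<^bold>\<rhd> (C \<^bold>\<or> D)) \<Longrightarrow> sat F V x (C \<^bold>\<rhd> D) \<Longrightarrow> sat F V x (B \<^bold>\<rhd> D)"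
      unfolding sat.simps(9) [of F V x B D] by blast
    then show "sat F V x A"
      unfolding A_eq sat.simps(5,7) by blast
  qed
  moreover have "valid F A" if A: "A \<in> J5" for A
    unfolding valid_def
  proof (intro allI ballI)
    fix V x
    assume "x \<in> worlds F"
    obtain B where "A = ((\<^bold>\<diamond> B) \<^bold>\<rhd> B)"
      using A by (auto simp: J5_def)
    then show "sat F V x A"
      using assms(4) by simp blast
  qed
  moreover have "IL_minus {J2_plus, J5} = IL_minus {} \<union> J2_plus \<union> J5"
    by (simp add: IL_minus_def Un_assoc)
  ultimately show ?thesis
    using assms(1) IL_minus_valid [OF assms(1)] unfolding frame_of_def by blast
qed

text \<open>Reflexivity of \<open>S\<close> gives \<open>J1\<close>. \<open>J2\<close> is reduced to
  \<open>J2_plus\<close> by weakening the consequent of its first conjunct to a disjunction.\<close>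

lemma frame_of_IL:
  assumes "frame_of F (IL_minus {J2_plus, J5})"
    and "\<And>x y. x \<in> worlds F \<Longrightarrow> (x, y) \<in> acc F \<Longrightarrow> (y, y) \<in> succ_rel F x"
  shows "frame_of F IL"
proof -
  have "valid F A" if A: "A \<in> J1" for A
    unfolding valid_def
  proof (intro allI ballI)
    fix V x
    assume "x \<in> worlds F"
    obtain B C where "A = (\<^bold>\<box> (B \<^bold>\<rightarrow> C) \<^bold>\<rightarrow> (B \<^bold>\<rhd> C))"
      using A by (auto simp: J1_def)
    then show "sat F V x A"
      using assms(2) [OF \<open>x \<in> worlds F\<close>] by auto
  qed
  moreover have "valid F A" if A: "A \<in> J2" for A
  proof -
    obtain B C D where A_eq: "A = (((B \<^bold>\<rhd> C) \<^bold>\<and> (C \<^bold>\<rhd> D)) \<^bold>\<rightarrow> (B \<^bold>\<rhd> D))"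
      using A by (auto simp: J2_def)
    have "valid F (((B \<^bold>\<rhd> (C \<^bold>\<or> D)) \<^bold>\<and> (C \<^bold>\<rhd> D)) \<^bold>\<rightarrow> (B \<^bold>\<rhd> D))"
      using assms(1) by (auto simp: frame_of_def IL_minus_def J2_plus_def)
    moreover have "sat F V x (B \<^bold>\<rhd> C) \<Longrightarrow> sat F V x (B \<^bold>\<rhd> (C \<^bold>\<or> D))" for V x
      by auto
    ultimately show ?thesis
      unfolding A_eq valid_def sat.simps(5,7) by blast
  qed
  ultimately show ?thesis
    using assms(1) by (simp add: frame_of_def IL_def IL_minus_def Un_assoc ball_Un)
qed

section \<open>Copying a finite frame into an arbitrary infinite type\<close>

definition pullback_frame :: "('a \<Rightarrow> 'b) \<Rightarrow> 'a set \<Rightarrow> 'b frame \<Rightarrow> 'a frame" where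
  "pullback_frame g U F =
     \<lparr>worlds = U,
      acc = inv_image (acc F) g \<inter> U \<times> U,
      succ_rel = (\<lambda>x. inv_image (succ_rel F (g x)) g \<inter> U \<times> U)\<rparr>"

lemma pullback_frame_sel [simp]:
  "worlds (pullback_frame g U F) = U"
  "acc (pullback_frame g U F) = inv_image (acc F) g \<inter> U \<times> U"
  "succ_rel (pullback_frame g U F) x = inv_image (succ_rel F (g x)) g \<inter> U \<times> U"
  by (simp_all add: pullback_frame_def)

lemma sat_pullback_frame:
  assumes "bij_betw g U (worlds F)" "IL_minus_frame F" "\<And>x. x \<in> U \<Longrightarrow> V x = V' (g x)" "x \<in> U"
  shows "sat (pullback_frame g U F) V x A = sat F V' (g x) A"
  using assms(4)
proof (induction A arbitrary: x)
  case (Box A)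
  have img: "\<exists>z\<in>U. y = g z" if "(g x, y) \<in> acc F" for y
    using that assms(1,2) by (auto simp: IL_minus_frame_def bij_betw_def)
  have "sat (pullback_frame g U F) V x (\<^bold>\<box> A) \<longleftrightarrow>
      (\<forall>y\<in>U. (g x, g y) \<in> acc F \<longrightarrow> sat F V' (g y) A)"
    using Box by auto
  also have "\<dots> \<longleftrightarrow> sat F V' (g x) (\<^bold>\<box> A)"
    unfolding sat.simps using img by blast
  finally show ?case .
next
  case (Rhd A B)
  have img1: "\<exists>z\<in>U. y = g z" if "(g x, y) \<in> acc F" for y
    using that assms(1,2) by (auto simp: IL_minus_frame_def bij_betw_def)
  have "g x \<in> worlds F"
    using assms(1) Rhd.prems by (auto simp: bij_betw_def)
  then have "succ_rel F (g x) \<subseteq> g ` U \<times> g ` U"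
    using assms(1,2) by (simp add: IL_minus_frame_def bij_betw_def)
  then have img2: "\<exists>z'\<in>U. z = g z'" if "(y, z) \<in> succ_rel F (g x)" for y z
    using that by blast
  let ?G = "pullback_frame g U F"
  have ex: "(\<exists>z. (y, z) \<in> succ_rel ?G x \<and> sat ?G V z B) \<longleftrightarrow>
      (\<exists>z. (g y, z) \<in> succ_rel F (g x) \<and> sat F V' z B)" (is "?lhs \<longleftrightarrow> ?rhs") if y: "y \<in> U" for y
  proof
    assume ?lhs
    then show ?rhs
      using Rhd.IH(2) by auto
  next
    assume ?rhs
    then obtain z where "z \<in> U" "(g y, g z) \<in> succ_rel F (g x)" "sat F V' (g z) B"
      using img2 by blast
    then show ?lhs
      using Rhd.IH(2) y by (intro exI [of _ z]) simp
  qed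
  have "sat ?G V x (A \<^bold>\<rhd> B) \<longleftrightarrow>
      (\<forall>y. (x, y) \<in> acc ?G \<longrightarrow> sat ?G V y A \<longrightarrow>
        (\<exists>z. (y, z) \<in> succ_rel ?G x \<and> sat ?G V z B))"
    unfolding sat.simps by blast
  also have "\<dots> \<longleftrightarrow> (\<forall>y\<in>U. (g x, g y) \<in> acc F \<longrightarrow> sat F V' (g y) A \<longrightarrow>
        (\<exists>z. (g y, z) \<in> succ_rel F (g x) \<and> sat F V' z B))"
    using Rhd.prems by (auto simp: Rhd.IH(1) ex simp del: pullback_frame_sel(3))
  also have "\<dots> \<longleftrightarrow> sat F V' (g x) (A \<^bold>\<rhd> B)"
    unfolding sat.simps using img1 by blast
  finally show ?case .
qed (use assms(3) in auto)

lemma IL_minus_frame_pullback: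
  assumes "bij_betw g U (worlds F)" "IL_minus_frame F"
  shows "IL_minus_frame (pullback_frame g U F)"
proof -
  have "trans (inv_image (acc F) g \<inter> U \<times> U)"
    using assms(2) by (auto simp: IL_minus_frame_def trans_def)
  moreover have "wf ((inv_image (acc F) g \<inter> U \<times> U)\<inverse>)"
    by (rule wf_subset [OF wf_inv_image [of "(acc F)\<inverse>" g]])
      (use assms(2) in \<open>auto simp: IL_minus_frame_def\<close>)
  moreover have "U \<noteq> {}"
    using assms by (auto simp: IL_minus_frame_def bij_betw_def)
  moreover have "g x \<in> worlds F" if "x \<in> U" for x
    using assms(1) that by (auto simp: bij_betw_def)
  ultimately show ?thesis
    using assms(2) unfolding IL_minus_frame_def pullback_frame_sel by simp metis
qed

lemma valid_pullback_frame:
  assumes "bij_betw g U (worlds F)" "IL_minus_frame F"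
  shows "valid (pullback_frame g U F) A \<longleftrightarrow> valid F A"
proof
  assume *: "valid (pullback_frame g U F) A"
  show "valid F A"
    unfolding valid_def
  proof (intro allI ballI)
    fix V x
    assume "x \<in> worlds F"
    then obtain y where "y \<in> U" "x = g y"
      using assms(1) by (auto simp: bij_betw_def)
    moreover have "sat (pullback_frame g U F) (V \<circ> g) y A \<longleftrightarrow> sat F V (g y) A"
      using \<open>y \<in> U\<close> by (intro sat_pullback_frame [OF assms]) simp_all
    ultimately show "sat F V x A"
      using * by (simp add: valid_def)
  qed
next
  assume *: "valid F A"
  show "valid (pullback_frame g U F) A"
    unfolding valid_def
  proof (intro allI ballI)
    fix V :: "'a \<Rightarrow> nat \<Rightarrow> bool" and x
    assume "x \<in> worlds (pullback_frame g U F)"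
    then have "x \<in> U"
      by simp
    then have "g x \<in> worlds F"
      using assms(1) by (auto simp: bij_betw_def)
    moreover have "sat (pullback_frame g U F) V x A \<longleftrightarrow> sat F (V \<circ> inv_into U g) (g x) A"
      using \<open>x \<in> U\<close> assms(1) by (intro sat_pullback_frame [OF assms]) (auto simp: bij_betw_def)
    ultimately show "sat (pullback_frame g U F) V x A"
      using * by (simp add: valid_def)
  qed
qed

text \<open>An infinite type has finite subsets of every cardinality, so one of them carries an
  isomorphic copy of \<open>F\<close>, which has the same valid formulas.\<close>

lemma transfer_finite_frame:
  fixes F :: "'a frame"
  assumes "infinite (UNIV :: 'w set)" "finite (worlds F)" "frame_of F L" "\<not> valid F A"
  shows "\<exists>G :: 'w frame. frame_of G L \<and> finite (worlds G) \<and> \<not> valid G A"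
proof -
  obtain U :: "'w set" where "finite U" "card U = card (worlds F)"
    using infinite_arbitrarily_large [OF assms(1)] by blast
  then obtain g where g: "bij_betw g U (worlds F)"
    using finite_same_card_bij assms(2) by blast
  have "IL_minus_frame F"
    using assms(3) by (simp add: frame_of_def)
  note F = g this
  have "finite (worlds (pullback_frame g U F))"
    using \<open>finite U\<close> by simp
  then show ?thesis
    using assms(3,4) IL_minus_frame_pullback [OF F] valid_pullback_frame [OF F]
    unfolding frame_of_def by blast
qed

section \<open>Maximal consistent sets\<close>

primrec disj_list :: "formula list \<Rightarrow> formula" where
  "disj_list [] = \<^bold>\<bottom>"
| "disj_list (A # As) = (A \<^bold>\<or> disj_list As)"

lemma prop_eval_disj_list [simp]: "prop_eval v (disj_list As) \<longleftrightarrow> (\<exists>A\<in>set As. prop_eval v A)"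
  by (induction As) auto

text \<open>Derivability is assumed in place of membership because \<open>IL\<close> proves
  \<open>J2_plus\<close> without having it as an axiom schema.\<close>

locale interpretability_logic =
  fixes L :: "formula set"
  assumes axioms_derivable: "A \<in> IL_minus {J2_plus, J5} \<Longrightarrow> L \<turnstile> A"
begin

lemma derivable_taut: "tautology A \<Longrightarrow> L \<turnstile> A"
  by (rule axioms_derivable) (simp add: IL_minus_def Taut_def)

lemma derivable_taut_mp:
  assumes "L \<turnstile> A" "\<And>v. prop_eval v A \<Longrightarrow> prop_eval v B"
  shows "L \<turnstile> B"
proof -
  have "L \<turnstile> (A \<^bold>\<rightarrow> B)"
    by (rule derivable_taut) (simp add: tautology_def assms(2))
  then show ?thesis
    using assms(1) by (rule modus_ponens)
qed

lemma derivable_taut_mp2: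
  assumes "L \<turnstile> A" "L \<turnstile> B" "\<And>v. prop_eval v A \<Longrightarrow> prop_eval v B \<Longrightarrow> prop_eval v C"
  shows "L \<turnstile> C"
proof -
  have "L \<turnstile> (B \<^bold>\<rightarrow> C)"
    by (rule derivable_taut_mp [OF assms(1)]) (simp add: assms(3))
  then show ?thesis
    using assms(2) by (rule modus_ponens)
qed

text \<open>Maximal consistency is encoded by closure conditions; the last clause states consistency
  and completeness at once.\<close>

definition mcs :: "formula set \<Rightarrow> bool" where
  "mcs M \<longleftrightarrow> (\<forall>A. L \<turnstile> A \<longrightarrow> A \<in> M) \<and>
     (\<forall>A B. (A \<^bold>\<rightarrow> B) \<in> M \<longrightarrow> A \<in> M \<longrightarrow> B \<in> M) \<and>
     (\<forall>A. (\<^bold>\<not> A) \<in> M \<longleftrightarrow> A \<notin> M)"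

lemma mcs_derivable: "mcs M \<Longrightarrow> L \<turnstile> A \<Longrightarrow> A \<in> M"
  by (simp add: mcs_def)

lemma mcs_Neg [simp]: "mcs M \<Longrightarrow> (\<^bold>\<not> A) \<in> M \<longleftrightarrow> A \<notin> M"
  by (simp add: mcs_def)

lemma mcs_mp: "mcs M \<Longrightarrow> L \<turnstile> (A \<^bold>\<rightarrow> B) \<Longrightarrow> A \<in> M \<Longrightarrow> B \<in> M"
  unfolding mcs_def by blast

lemma mcs_taut_mp:
  assumes "mcs M" "A \<in> M" "\<And>v. prop_eval v A \<Longrightarrow> prop_eval v B"
  shows "B \<in> M"
  using assms(1) derivable_taut assms(2)
  by (rule mcs_mp) (simp add: tautology_def assms(3))

lemma mcs_taut_mp2:
  assumes "mcs M" "A \<in> M" "B \<in> M" "\<And>v. prop_eval v A \<Longrightarrow> prop_eval v B \<Longrightarrow> prop_eval v C"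
  shows "C \<in> M"
proof -
  have "(B \<^bold>\<rightarrow> C) \<in> M"
    using assms(1,2) by (rule mcs_taut_mp) (simp add: assms(4))
  then show ?thesis
    using assms(1,3) by (auto simp: mcs_def)
qed

lemma mcs_Top [simp]:
  assumes "mcs M"
  shows "\<^bold>\<top> \<in> M"
proof -
  have "L \<turnstile> \<^bold>\<top>"
    by (rule derivable_taut) (simp add: tautology_def)
  then show ?thesis
    by (rule mcs_derivable [OF assms])
qed

lemma mcs_Bot [simp]:
  assumes "mcs M"
  shows "\<^bold>\<bottom> \<notin> M"
proof -
  have "L \<turnstile> (\<^bold>\<not> \<^bold>\<bottom>)"
    by (rule derivable_taut) (simp add: tautology_def)
  then have "(\<^bold>\<not> \<^bold>\<bottom>) \<in> M"
    by (rule mcs_derivable [OF assms])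
  then show ?thesis
    using assms by simp
qed

lemma mcs_Conj [simp]:
  assumes "mcs M"
  shows "(A \<^bold>\<and> B) \<in> M \<longleftrightarrow> A \<in> M \<and> B \<in> M"
proof (intro iffI conjI)
  assume "(A \<^bold>\<and> B) \<in> M"
  then show "A \<in> M" "B \<in> M"
    by (rule mcs_taut_mp [OF assms], simp)+
next
  assume "A \<in> M \<and> B \<in> M"
  then show "(A \<^bold>\<and> B) \<in> M"
    by (elim conjE) (rule mcs_taut_mp2 [OF assms, of A B], simp_all)
qed

lemma mcs_Disj [simp]:
  assumes "mcs M"
  shows "(A \<^bold>\<or> B) \<in> M \<longleftrightarrow> A \<in> M \<or> B \<in> M"
proof
  assume *: "(A \<^bold>\<or> B) \<in> M"
  have "B \<in> M" if "A \<notin> M"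
  proof -
    have "(\<^bold>\<not> A) \<in> M"
      using that assms by simp
    with * show ?thesis
      by (rule mcs_taut_mp2 [OF assms]) auto
  qed
  then show "A \<in> M \<or> B \<in> M"
    by blast
next
  assume "A \<in> M \<or> B \<in> M"
  then show "(A \<^bold>\<or> B) \<in> M"
    by (elim disjE; elim mcs_taut_mp [OF assms]) simp_all
qed

lemma mcs_Imp [simp]:
  assumes "mcs M"
  shows "(A \<^bold>\<rightarrow> B) \<in> M \<longleftrightarrow> (A \<in> M \<longrightarrow> B \<in> M)"
proof
  assume "(A \<^bold>\<rightarrow> B) \<in> M"
  then show "A \<in> M \<longrightarrow> B \<in> M"
    using assms by (simp add: mcs_def)
next
  assume "A \<in> M \<longrightarrow> B \<in> M"
  then have "(\<^bold>\<not> A) \<in> M \<or> B \<in> M"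
    using assms by auto
  then show "(A \<^bold>\<rightarrow> B) \<in> M"
    by (elim disjE; elim mcs_taut_mp [OF assms]) simp_all
qed

text \<open>The dual of consistency: \<open>N\<close> is refutable when the negations of its members
  are jointly consistent. The dual form suits critical successors, which are specified by the
  formulas they must omit.\<close>

definition refutable :: "formula set \<Rightarrow> bool" where
  "refutable N \<longleftrightarrow> (\<forall>As. set As \<subseteq> N \<longrightarrow> \<not> L \<turnstile> disj_list As)"

lemma refutable_Union_chain:
  assumes "subset.chain (Collect refutable) \<C>" "\<C> \<noteq> {}"
  shows "refutable (\<Union>\<C>)"
  unfolding refutable_def
proof (intro allI impI)
  fix As
  assume "set As \<subseteq> \<Union>\<C>"
  then obtain N where "N \<in> \<C>" "set As \<subseteq> N"
    using finite_subset_Union_chain [OF _ _ assms(2,1)] by blast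
  then show "\<not> L \<turnstile> disj_list As"
    using assms(1) by (auto simp: subset.chain_def refutable_def)
qed

text \<open>If \<open>A\<close> lies outside \<open>N\<close>, then by maximality adding
  \<open>A\<close> produces a derivable disjunction, so \<open>A\<close> or some finite disjunction
  over \<open>N\<close> is derivable. Such derivable disjunctions can be combined propositionally,
  which gives the closure properties of the complement.\<close>

lemma mcs_Compl_maximal_refutable:
  assumes ref: "refutable N" and max: "\<And>N'. refutable N' \<Longrightarrow> N \<subseteq> N' \<Longrightarrow> N' = N"
  shows "mcs (- N)"
proof -
  have disj: "\<exists>As. set As \<subseteq> N \<and> L \<turnstile> (A \<^bold>\<or> disj_list As)" if "A \<notin> N" for A
  proof -
    have "\<not> refutable (insert A N)"
      using max [of "insert A N"] that by blast
    then obtain As where As: "set As \<subseteq> insert A N" "L \<turnstile> disj_list As"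
      by (auto simp: refutable_def)
    let ?As = "filter (\<lambda>B. B \<noteq> A) As"
    have "L \<turnstile> (A \<^bold>\<or> disj_list ?As)"
      by (rule derivable_taut_mp [OF As(2)]) auto
    moreover have "set ?As \<subseteq> N"
      using As(1) by auto
    ultimately show ?thesis
      by blast
  qed
  \<comment> \<open>This covers modus ponens and, together with \<open>Bot\<close>, the consistency
    of the complement.\<close>
  have closed: "C \<notin> N"
    if A: "A \<notin> N" and B: "B \<notin> N"
      and C: "\<And>v. prop_eval v A \<Longrightarrow> prop_eval v B \<Longrightarrow> prop_eval v C" for A B C
  proof
    assume "C \<in> N"
    obtain As where As: "set As \<subseteq> N" "L \<turnstile> (A \<^bold>\<or> disj_list As)"
      using disj [OF A] by blast
    obtain Bs where Bs: "set Bs \<subseteq> N" "L \<turnstile> (B \<^bold>\<or> disj_list Bs)"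
      using disj [OF B] by blast
    have "L \<turnstile> disj_list (C # As @ Bs)"
      by (rule derivable_taut_mp2 [OF As(2) Bs(2)]) (use C in auto)
    moreover have "set (C # As @ Bs) \<subseteq> N"
      using As(1) Bs(1) \<open>C \<in> N\<close> by simp
    ultimately show False
      using ref unfolding refutable_def by blast
  qed
  have thms: "A \<notin> N" if "L \<turnstile> A" for A
  proof
    assume "A \<in> N"
    have "L \<turnstile> disj_list [A]"
      by (rule derivable_taut_mp [OF that]) simp
    moreover have "set [A] \<subseteq> N"
      using \<open>A \<in> N\<close> by simp
    ultimately show False
      using ref unfolding refutable_def by blast
  qed
  have Bot: "\<^bold>\<bottom> \<in> N"
  proof (rule ccontr)
    assume "\<^bold>\<bottom> \<notin> N"
    then obtain As where As: "set As \<subseteq> N" "L \<turnstile> (\<^bold>\<bottom> \<^bold>\<or> disj_list As)"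
      using disj by blast
    have "L \<turnstile> disj_list As"
      by (rule derivable_taut_mp [OF As(2)]) simp
    then show False
      using ref As(1) by (simp add: refutable_def)
  qed
  have "A \<notin> N \<or> (\<^bold>\<not> A) \<notin> N" for A
  proof -
    have "L \<turnstile> disj_list [A, \<^bold>\<not> A]"
      by (rule derivable_taut) (simp add: tautology_def)
    then have "\<not> set [A, \<^bold>\<not> A] \<subseteq> N"
      using ref unfolding refutable_def by blast
    then show ?thesis
      by simp
  qed
  moreover have "A \<in> N \<or> (\<^bold>\<not> A) \<in> N" for A
  proof (rule ccontr)
    assume "\<not> ?thesis"
    then have "A \<notin> N" "(\<^bold>\<not> A) \<notin> N"
      by simp_all
    then have "\<^bold>\<bottom> \<notin> N"
      by (rule closed) simp
    then show False
      using Bot by blast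
  qed
  moreover have "B \<notin> N" if "(A \<^bold>\<rightarrow> B) \<notin> N" "A \<notin> N" for A B
    by (rule closed [OF that]) simp
  ultimately show ?thesis
    unfolding mcs_def using thms by blast
qed

lemma Lindenbaum:
  assumes "refutable N"
  shows "\<exists>M. mcs M \<and> M \<inter> N = {}"
proof -
  let ?\<N> = "{N'. refutable N' \<and> N \<subseteq> N'}"
  have "\<exists>M\<in>?\<N>. \<forall>X\<in>?\<N>. M \<subseteq> X \<longrightarrow> X = M"
  proof (rule subset_Zorn_nonempty)
    show "?\<N> \<noteq> {}"
      using assms by blast
  next
    fix \<C>
    assume \<C>: "\<C> \<noteq> {}" "subset.chain ?\<N> \<C>"
    then have "subset.chain (Collect refutable) \<C>"
      by (auto simp: subset.chain_def)
    then have "refutable (\<Union>\<C>)"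
      using \<C>(1) by (rule refutable_Union_chain)
    moreover have "N \<subseteq> N'" if "N' \<in> \<C>" for N'
      using \<C>(2) that by (auto simp: subset.chain_def)
    then have "N \<subseteq> \<Union>\<C>"
      using \<C>(1) by (meson Union_upper ex_in_conv subset_trans)
    ultimately show "\<Union>\<C> \<in> ?\<N>"
      by blast
  qed
  then obtain N' where "N' \<in> ?\<N>" and max: "\<forall>X\<in>?\<N>. N' \<subseteq> X \<longrightarrow> X = N'"
    by (rule bexE)
  then have N': "refutable N'" "N \<subseteq> N'"
    by simp_all
  have "mcs (- N')"
    using N'(1)
  proof (rule mcs_Compl_maximal_refutable)
    show "X = N'" if "refutable X" "N' \<subseteq> X" for X
      using max that subset_trans [OF N'(2) that(2)] by simp
  qed
  then show ?thesis
    using N'(2) by blast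
qed

section \<open>Critical successors\<close>

lemma mcs_axiom: "mcs M \<Longrightarrow> A \<in> IL_minus {J2_plus, J5} \<Longrightarrow> A \<in> M"
  by (simp add: mcs_derivable axioms_derivable)

lemma mcs_K:
  assumes "mcs M" "(\<^bold>\<box> (A \<^bold>\<rightarrow> B)) \<in> M" "(\<^bold>\<box> A) \<in> M"
  shows "(\<^bold>\<box> B) \<in> M"
  using assms mcs_axiom [of M "\<^bold>\<box> (A \<^bold>\<rightarrow> B) \<^bold>\<rightarrow> (\<^bold>\<box> A \<^bold>\<rightarrow> \<^bold>\<box> B)"]
  by (auto simp: IL_minus_def K_def)

lemma mcs_Box_mono:
  assumes "mcs M" "L \<turnstile> (A \<^bold>\<rightarrow> B)" "(\<^bold>\<box> A) \<in> M"
  shows "(\<^bold>\<box> B) \<in> M"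
  using mcs_K [OF assms(1) _ assms(3)] mcs_derivable [OF assms(1) necessitation [OF assms(2)]] .

lemma mcs_Loeb:
  assumes "mcs M" "(\<^bold>\<box> (\<^bold>\<box> A \<^bold>\<rightarrow> A)) \<in> M"
  shows "(\<^bold>\<box> A) \<in> M"
  using assms mcs_axiom [of M "\<^bold>\<box> (\<^bold>\<box> A \<^bold>\<rightarrow> A) \<^bold>\<rightarrow> \<^bold>\<box> A"]
  by (auto simp: IL_minus_def Loeb_def)

text \<open>Lindenbaum for \<open>{A}\<close>: a disjunction of copies of \<open>A\<close>, possibly
  empty, entails \<open>A\<close>. Derivations can thus be replaced by arguments inside an arbitrary
  maximal consistent set.\<close>

lemma derivable_if_mcs: "(\<And>M. mcs M \<Longrightarrow> A \<in> M) \<Longrightarrow> L \<turnstile> A"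
proof (rule ccontr)
  assume *: "\<And>M. mcs M \<Longrightarrow> A \<in> M" and "\<not> L \<turnstile> A"
  have "refutable {A}"
    unfolding refutable_def
  proof (intro allI impI notI)
    fix As
    assume As: "set As \<subseteq> {A}" "L \<turnstile> disj_list As"
    have "L \<turnstile> A"
      by (rule derivable_taut_mp [OF As(2)]) (use As(1) in auto)
    then show False
      using \<open>\<not> L \<turnstile> A\<close> by blast
  qed
  then show False
    using Lindenbaum * by blast
qed

lemma mcs_Box_trans:
  assumes "mcs M" "(\<^bold>\<box> A) \<in> M"
  shows "(\<^bold>\<box> \<^bold>\<box> A) \<in> M"
proof -
  have 1: "L \<turnstile> (A \<^bold>\<and> \<^bold>\<box> A \<^bold>\<rightarrow> A)" and 2: "L \<turnstile> (A \<^bold>\<and> \<^bold>\<box> A \<^bold>\<rightarrow> \<^bold>\<box> A)"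
    by (auto intro: derivable_taut simp: tautology_def)
  \<comment> \<open>Transitivity is not an axiom; it follows from Loeb's principle applied to the
    conjunction of \<open>A\<close> and \<open>\<box> A\<close>.\<close>
  have "L \<turnstile> (A \<^bold>\<rightarrow> (\<^bold>\<box> (A \<^bold>\<and> \<^bold>\<box> A) \<^bold>\<rightarrow> A \<^bold>\<and> \<^bold>\<box> A))"
    by (rule derivable_if_mcs) (auto intro: mcs_Box_mono [OF _ 1])
  then have "(\<^bold>\<box> (A \<^bold>\<and> \<^bold>\<box> A)) \<in> M"
    using assms mcs_Box_mono mcs_Loeb by blast
  then show ?thesis
    using assms(1) 2 mcs_Box_mono by blast
qed

lemma mcs_R1: "mcs M \<Longrightarrow> L \<turnstile> (A \<^bold>\<rightarrow> B) \<Longrightarrow> (C \<^bold>\<rhd> A) \<in> M \<Longrightarrow> (C \<^bold>\<rhd> B) \<in> M"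
  by (meson R1 mcs_mp)

lemma mcs_R2: "mcs M \<Longrightarrow> L \<turnstile> (A \<^bold>\<rightarrow> B) \<Longrightarrow> (B \<^bold>\<rhd> C) \<in> M \<Longrightarrow> (A \<^bold>\<rhd> C) \<in> M"
  by (meson R2 mcs_mp)

lemma mcs_J3:
  assumes "mcs M" "(A \<^bold>\<rhd> C) \<in> M" "(B \<^bold>\<rhd> C) \<in> M"
  shows "((A \<^bold>\<or> B) \<^bold>\<rhd> C) \<in> M"
  using assms mcs_axiom [of M "((A \<^bold>\<rhd> C) \<^bold>\<and> (B \<^bold>\<rhd> C)) \<^bold>\<rightarrow> ((A \<^bold>\<or> B) \<^bold>\<rhd> C)"]
  by (auto simp: IL_minus_def J3_def)

lemma mcs_J6:
  assumes "mcs M"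
  shows "(\<^bold>\<box> A) \<in> M \<longleftrightarrow> ((\<^bold>\<not> A) \<^bold>\<rhd> \<^bold>\<bottom>) \<in> M"
  using assms mcs_axiom [of M "\<^bold>\<box> A \<^bold>\<leftrightarrow> ((\<^bold>\<not> A) \<^bold>\<rhd> \<^bold>\<bottom>)"]
  by (auto simp: IL_minus_def J6_def)

lemma mcs_J2_plus:
  assumes "mcs M" "(A \<^bold>\<rhd> (B \<^bold>\<or> C)) \<in> M" "(B \<^bold>\<rhd> C) \<in> M"
  shows "(A \<^bold>\<rhd> C) \<in> M"
  using assms mcs_axiom [of M "((A \<^bold>\<rhd> (B \<^bold>\<or> C)) \<^bold>\<and> (B \<^bold>\<rhd> C)) \<^bold>\<rightarrow> (A \<^bold>\<rhd> C)"]
  by (auto simp: IL_minus_def J2_plus_def)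

lemma mcs_J2:
  assumes "mcs M" "(A \<^bold>\<rhd> B) \<in> M" "(B \<^bold>\<rhd> C) \<in> M"
  shows "(A \<^bold>\<rhd> C) \<in> M"
proof -
  have "L \<turnstile> (B \<^bold>\<rightarrow> (B \<^bold>\<or> C))"
    by (auto intro: derivable_taut simp: tautology_def)
  then show ?thesis
    using assms mcs_R1 mcs_J2_plus by blast
qed

lemma mcs_J5: "mcs M \<Longrightarrow> ((\<^bold>\<diamond> A) \<^bold>\<rhd> A) \<in> M"
  by (rule mcs_axiom) (auto simp: IL_minus_def J5_def)

lemma mcs_Dia_Rhd: "mcs M \<Longrightarrow> (A \<^bold>\<rhd> B) \<in> M \<Longrightarrow> ((\<^bold>\<diamond> A) \<^bold>\<rhd> B) \<in> M"
  using mcs_J5 mcs_J2 by blast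

text \<open>Because of this, omitting every \<open>B\<close> with \<open>B \<rhd> C\<close> in
  \<open>M\<close> already forces a set to contain all formulas that are boxed in
  \<open>M\<close>.\<close>

lemma mcs_Box_Rhd:
  assumes "mcs M" "(\<^bold>\<box> A) \<in> M"
  shows "((\<^bold>\<not> A) \<^bold>\<rhd> B) \<in> M"
proof -
  have "L \<turnstile> (\<^bold>\<bottom> \<^bold>\<rightarrow> B)"
    by (auto intro: derivable_taut simp: tautology_def)
  then show ?thesis
    using assms mcs_J6 mcs_R1 by blast
qed

lemma mcs_disj_list_Rhd:
  assumes "mcs M" "\<And>B. B \<in> set Bs \<Longrightarrow> (B \<^bold>\<rhd> C) \<in> M"
  shows "(disj_list Bs \<^bold>\<rhd> C) \<in> M"
  using assms(2)
proof (induction Bs)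
  case Nil
  \<comment> \<open>The empty disjunction: \<open>J6\<close> applied to the derivable box of the
    negation of \<open>\<bottom>\<close>, followed by \<open>R2\<close>.\<close>
  have "L \<turnstile> (\<^bold>\<not> \<^bold>\<bottom>)" "L \<turnstile> (\<^bold>\<bottom> \<^bold>\<rightarrow> \<^bold>\<not> \<^bold>\<not> \<^bold>\<bottom>)"
    by (auto intro: derivable_taut simp: tautology_def)
  then show ?case
    using assms(1) mcs_R2 mcs_Box_Rhd mcs_derivable necessitation by (metis disj_list.simps(1))
next
  case (Cons B Bs)
  then show ?case
    using mcs_J3 assms(1) by simp
qed

text \<open>Loeb's principle makes every \<open>A\<close>-point see, or be, a last \<open>A\<close>-point, and \<open>J5\<close> lets
  \<open>\<rhd>\<close> be tested on last points only.\<close>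

lemma mcs_Rhd_last:
  assumes "mcs M" "((A \<^bold>\<and> \<^bold>\<box> \<^bold>\<not> A) \<^bold>\<rhd> C) \<in> M"
  shows "(A \<^bold>\<rhd> C) \<in> M"
proof -
  let ?P = "A \<^bold>\<and> \<^bold>\<box> \<^bold>\<not> A"
  have imp: "L \<turnstile> ((\<^bold>\<not> ?P) \<^bold>\<rightarrow> (\<^bold>\<box> \<^bold>\<not> A \<^bold>\<rightarrow> \<^bold>\<not> A))"
    by (auto intro: derivable_taut simp: tautology_def)
  have "L \<turnstile> (A \<^bold>\<rightarrow> (?P \<^bold>\<or> \<^bold>\<diamond> ?P))"
    by (rule derivable_if_mcs) (auto intro: mcs_Loeb mcs_Box_mono [OF _ imp])
  moreover have "((?P \<^bold>\<or> \<^bold>\<diamond> ?P) \<^bold>\<rhd> C) \<in> M"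
    using assms mcs_J3 mcs_Dia_Rhd by blast
  ultimately show ?thesis
    using assms(1) mcs_R2 by blast
qed

text \<open>Let \<open>M'\<close> omit the negation of \<open>?P\<close> and every \<open>B\<close>
  with \<open>B \<rhd> C\<close> in \<open>M\<close>. If this were impossible, \<open>?P\<close>
  would imply a finite disjunction of such \<open>B\<close>; \<open>J3\<close> and \<open>R2\<close>
  would give \<open>?P \<rhd> C\<close>, and the reduction to last points \<open>A \<rhd> C\<close>.
  The other properties follow from what is omitted.\<close>

lemma critical_successor_exists:
  assumes "mcs M" "(A \<^bold>\<rhd> C) \<notin> M"
  obtains M' where "mcs M'" "A \<in> M'" "(\<^bold>\<box> \<^bold>\<not> A) \<in> M'" "(\<^bold>\<box> \<^bold>\<not> A) \<notin> M" "(\<^bold>\<box> \<^bold>\<not> C) \<in> M'"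
    "\<forall>B. (B \<^bold>\<rhd> C) \<in> M \<longrightarrow> B \<notin> M' \<and> (\<^bold>\<box> \<^bold>\<not> B) \<in> M'"
    "\<forall>B. (\<^bold>\<box> B) \<in> M \<longrightarrow> B \<in> M' \<and> (\<^bold>\<box> B) \<in> M'"
proof -
  let ?P = "A \<^bold>\<and> \<^bold>\<box> \<^bold>\<not> A"
  have "refutable (insert (\<^bold>\<not> ?P) {B. (B \<^bold>\<rhd> C) \<in> M})"
    unfolding refutable_def
  proof (intro allI impI notI)
    fix As
    assume As: "set As \<subseteq> insert (\<^bold>\<not> ?P) {B. (B \<^bold>\<rhd> C) \<in> M}" "L \<turnstile> disj_list As"
    let ?Bs = "filter (\<lambda>B. B \<noteq> \<^bold>\<not> ?P) As"
    have "(disj_list ?Bs \<^bold>\<rhd> C) \<in> M"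
      using As(1) by (intro mcs_disj_list_Rhd [OF assms(1)]) auto
    moreover have "L \<turnstile> (?P \<^bold>\<rightarrow> disj_list ?Bs)"
      by (rule derivable_taut_mp [OF As(2)]) auto
    ultimately have "(?P \<^bold>\<rhd> C) \<in> M"
      using assms(1) mcs_R2 by blast
    then show False
      using assms mcs_Rhd_last by blast
  qed
  then obtain M' where "mcs M'" and M': "M' \<inter> insert (\<^bold>\<not> ?P) {B. (B \<^bold>\<rhd> C) \<in> M} = {}"
    using Lindenbaum by blast
  have crit: "B \<notin> M'" if "(B \<^bold>\<rhd> C) \<in> M" for B
    using M' that by blast
  have crit_Box: "(\<^bold>\<box> \<^bold>\<not> B) \<in> M'" if "((\<^bold>\<diamond> B) \<^bold>\<rhd> C) \<in> M" for B
    using crit [OF that] \<open>mcs M'\<close> by simp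
  have succ: "B \<in> M'" if "(\<^bold>\<box> B) \<in> M" for B
    using crit [OF mcs_Box_Rhd [OF assms(1) that]] \<open>mcs M'\<close> by simp
  have "(\<^bold>\<not> ?P) \<notin> M'"
    using M' by blast
  then have "A \<in> M'" "(\<^bold>\<box> \<^bold>\<not> A) \<in> M'"
    using \<open>mcs M'\<close> by simp_all
  moreover have "(\<^bold>\<box> \<^bold>\<not> A) \<notin> M"
    using succ [of "\<^bold>\<not> A"] \<open>A \<in> M'\<close> \<open>mcs M'\<close> by auto
  \<comment> \<open>\<open>J5\<close> says \<open>\<diamond> C \<rhd> C\<close>, so
    \<open>\<diamond> C\<close> is omitted even when \<open>C\<close> itself is not.\<close>
  moreover have "(\<^bold>\<box> \<^bold>\<not> C) \<in> M'"
    by (rule crit_Box [OF mcs_J5 [OF assms(1)]])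
  moreover have "(\<^bold>\<box> \<^bold>\<not> B) \<in> M'" if "(B \<^bold>\<rhd> C) \<in> M" for B
    by (rule crit_Box [OF mcs_Dia_Rhd [OF assms(1) that]])
  moreover have "(\<^bold>\<box> B) \<in> M'" if "(\<^bold>\<box> B) \<in> M" for B
    by (rule succ [OF mcs_Box_trans [OF assms(1) that]])
  ultimately show thesis
    using \<open>mcs M'\<close> crit succ by (intro that [of M']) simp_all
qed

end

section \<open>The finite canonical frame\<close>

text \<open>The formulas whose boxes matter. Single negations serve criticality; a successor
  satisfying \<open>A\<close> is found through the negation of \<open>A\<close>, where
  \<open>A\<close> may be a member of \<open>S\<close>, the negation of one, or \<open>B\<close>
  together with the negation of \<open>C\<close>.\<close>

definition boxed :: "formula set \<Rightarrow> formula set" where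
  "boxed S = S \<union> Neg ` (S \<union> Neg ` S \<union> (\<lambda>(B, C). B \<^bold>\<and> \<^bold>\<not> C) ` (S \<times> S))"

lemma finite_boxed: "finite S \<Longrightarrow> finite (boxed S)"
  by (simp add: boxed_def)

lemma boxed_intros:
  assumes "B \<in> S"
  shows "B \<in> boxed S" "(\<^bold>\<not> B) \<in> boxed S" "(\<^bold>\<not> \<^bold>\<not> B) \<in> boxed S"
    "C \<in> S \<Longrightarrow> (\<^bold>\<not> (B \<^bold>\<and> \<^bold>\<not> C)) \<in> boxed S"
  using assms by (auto simp: boxed_def)

text \<open>The worlds are built from a finite set \<open>X\<close> of maximal consistent sets of arbitrary formulas
  which represents all of them up to agreement on the formulas that the frame inspects.\<close>

locale canonical = interpretability_logic +
  fixes S :: "formula set" and X :: "formula set set"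
  assumes finite_S: "finite S" and finite_X: "finite X"
    and mcs_X: "\<Gamma> \<in> X \<Longrightarrow> mcs \<Gamma>"
    and represent: "mcs M \<Longrightarrow>
      \<exists>\<Gamma>\<in>X. \<Gamma> \<inter> (boxed S \<union> Box ` boxed S) = M \<inter> (boxed S \<union> Box ` boxed S)"
begin

text \<open>Accessibility as in provability logic, restricted to \<open>boxed S\<close>; the second
  clause makes the set of boxed formulas grow strictly.\<close>

definition succ :: "formula set \<Rightarrow> formula set \<Rightarrow> bool" where
  "succ \<Gamma> \<Delta> \<longleftrightarrow> (\<forall>B\<in>boxed S. (\<^bold>\<box> B) \<in> \<Gamma> \<longrightarrow> B \<in> \<Delta> \<and> (\<^bold>\<box> B) \<in> \<Delta>) \<and>
     (\<exists>B\<in>boxed S. (\<^bold>\<box> B) \<in> \<Delta> \<and> (\<^bold>\<box> B) \<notin> \<Gamma>)"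

text \<open>The clause on \<open>C\<close> is separate because \<open>C \<rhd> C\<close> may be
  absent from \<open>\<Gamma>\<close>. It makes all further successors refute \<open>C\<close>, as
  \<open>J5\<close> demands.\<close>

definition critical :: "formula \<Rightarrow> formula set \<Rightarrow> formula set \<Rightarrow> bool" where
  "critical C \<Gamma> \<Delta> \<longleftrightarrow> (\<^bold>\<box> \<^bold>\<not> C) \<in> \<Delta> \<and>
     (\<forall>B\<in>S. (B \<^bold>\<rhd> C) \<in> \<Gamma> \<longrightarrow> B \<notin> \<Delta> \<and> (\<^bold>\<box> \<^bold>\<not> B) \<in> \<Delta>)"

definition depth :: "formula set \<Rightarrow> nat" where
  "depth \<Gamma> = card {B \<in> boxed S. (\<^bold>\<box> B) \<in> \<Gamma>}"

lemma succ_trans: "succ \<Gamma> \<Delta> \<Longrightarrow> succ \<Delta> \<Theta> \<Longrightarrow> succ \<Gamma> \<Theta>"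
  unfolding succ_def by blast

lemma depth_less: "succ \<Gamma> \<Delta> \<Longrightarrow> depth \<Gamma> < depth \<Delta>"
  unfolding depth_def succ_def
  by (intro psubset_card_mono) (auto simp: finite_boxed finite_S)

text \<open>The critical successor is replaced by its representative in \<open>X\<close>.
  Criticality is guarded by \<open>C \<in> S\<close> because \<open>C\<close> is also taken to be
  \<open>\<bottom>\<close>, when any successor satisfying \<open>A\<close> will do.\<close>

lemma critical_successor_in_X:
  assumes "\<Gamma> \<in> X" "(A \<^bold>\<rhd> C) \<notin> \<Gamma>" "(\<^bold>\<not> A) \<in> boxed S"
  shows "\<exists>\<Delta>\<in>X. A \<in> \<Delta> \<and> succ \<Gamma> \<Delta> \<and> (C \<in> S \<longrightarrow> critical C \<Gamma> \<Delta>)"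
proof -
  obtain M where "mcs M" and M: "A \<in> M" "(\<^bold>\<box> \<^bold>\<not> A) \<in> M" "(\<^bold>\<box> \<^bold>\<not> A) \<notin> \<Gamma>" "(\<^bold>\<box> \<^bold>\<not> C) \<in> M"
    and crit: "\<forall>B. (B \<^bold>\<rhd> C) \<in> \<Gamma> \<longrightarrow> B \<notin> M \<and> (\<^bold>\<box> \<^bold>\<not> B) \<in> M"
    and box: "\<forall>B. (\<^bold>\<box> B) \<in> \<Gamma> \<longrightarrow> B \<in> M \<and> (\<^bold>\<box> B) \<in> M"
    by (rule critical_successor_exists [OF mcs_X [OF assms(1)] assms(2)])
  obtain \<Delta> where "\<Delta> \<in> X"
      and \<Delta>: "\<Delta> \<inter> (boxed S \<union> Box ` boxed S) = M \<inter> (boxed S \<union> Box ` boxed S)"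
    using represent [OF \<open>mcs M\<close>] by blast
  have eq: "B \<in> \<Delta> \<longleftrightarrow> B \<in> M" "(\<^bold>\<box> B) \<in> \<Delta> \<longleftrightarrow> (\<^bold>\<box> B) \<in> M" if "B \<in> boxed S" for B
    using that arg_cong [OF \<Delta>, of "\<lambda>T. B \<in> T"] arg_cong [OF \<Delta>, of "\<lambda>T. (\<^bold>\<box> B) \<in> T"]
    by simp_all
  \<comment> \<open>\<open>A\<close> itself may lie outside \<open>boxed S\<close>, but agreement on
    its negation suffices.\<close>
  have "A \<in> \<Delta>"
    using eq(1) [OF assms(3)] M(1) mcs_X [OF \<open>\<Delta> \<in> X\<close>] \<open>mcs M\<close> by simp
  moreover have "succ \<Gamma> \<Delta>"
    unfolding succ_def
  proof
    show "\<forall>B\<in>boxed S. (\<^bold>\<box> B) \<in> \<Gamma> \<longrightarrow> B \<in> \<Delta> \<and> (\<^bold>\<box> B) \<in> \<Delta>"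
      by (simp add: eq box)
    show "\<exists>B\<in>boxed S. (\<^bold>\<box> B) \<in> \<Delta> \<and> (\<^bold>\<box> B) \<notin> \<Gamma>"
      using M(2,3) by (intro bexI [of _ "\<^bold>\<not> A"]) (simp_all add: eq assms(3))
  qed
  moreover have "critical C \<Gamma> \<Delta>" if "C \<in> S"
    unfolding critical_def
    using that M(4) by (simp add: eq crit boxed_intros(1,2))
  ultimately show ?thesis
    using \<open>\<Delta> \<in> X\<close> by blast
qed

type_synonym world = "formula set \<times> formula list"

text \<open>The length bound keeps the set of worlds finite. Since \<open>depth\<close> grows along
  \<open>succ\<close>, it always leaves room for one more label.\<close>

definition canonical_worlds :: "world set" where
  "canonical_worlds = {(\<Gamma>, \<tau>). \<Gamma> \<in> X \<and> set \<tau> \<subseteq> S \<and> length \<tau> \<le> depth \<Gamma>}"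

text \<open>The label of a successor relative to \<open>(\<Gamma>, \<tau>)\<close> is the first
  entry after \<open>\<tau>\<close>; later entries belong to intermediate worlds. Proper extension
  of the list makes the relation irreflexive.\<close>

definition canonical_acc :: "(world \<times> world) set" where
  "canonical_acc = {((\<Gamma>, \<tau>), (\<Delta>, \<sigma>)).
     (\<Gamma>, \<tau>) \<in> canonical_worlds \<and> (\<Delta>, \<sigma>) \<in> canonical_worlds \<and> succ \<Gamma> \<Delta> \<and> (\<exists>C \<rho>. \<sigma> = \<tau> @ C # \<rho>)}"

text \<open>A target of a critical world is critical again, so the conditional chains and the
  relation is transitive. From a world that is not critical, only the label must be kept.\<close>

definition canonical_succ_rel :: "world \<Rightarrow> (world \<times> world) set" where
  "canonical_succ_rel = (\<lambda>(\<Gamma>, \<tau>). {((\<Delta>, \<sigma>), (\<Delta>', \<sigma>')).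
     ((\<Gamma>, \<tau>), (\<Delta>, \<sigma>)) \<in> canonical_acc \<and> ((\<Gamma>, \<tau>), (\<Delta>', \<sigma>')) \<in> canonical_acc \<and>
     (\<exists>C \<rho> \<rho>'. \<sigma> = \<tau> @ C # \<rho> \<and> \<sigma>' = \<tau> @ C # \<rho>' \<and>
       (critical C \<Gamma> \<Delta> \<longrightarrow> critical C \<Gamma> \<Delta>' \<and> C \<notin> \<Delta>'))})"

definition canonical_frame :: "world frame" where
  "canonical_frame =
     \<lparr>worlds = canonical_worlds, acc = canonical_acc, succ_rel = canonical_succ_rel\<rparr>"

lemma canonical_frame_sel [simp]:
  "worlds canonical_frame = canonical_worlds"
  "acc canonical_frame = canonical_acc"
  "succ_rel canonical_frame = canonical_succ_rel"
  by (simp_all add: canonical_frame_def)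

lemma finite_canonical_worlds: "finite canonical_worlds"
proof (rule finite_subset)
  have "depth \<Gamma> \<le> card (boxed S)" for \<Gamma>
    unfolding depth_def by (rule card_mono) (auto simp: finite_boxed finite_S)
  then show "canonical_worlds \<subseteq> X \<times> {\<tau>. set \<tau> \<subseteq> S \<and> length \<tau> \<le> card (boxed S)}"
    by (auto simp: canonical_worlds_def intro: le_trans)
  show "finite (X \<times> {\<tau>. set \<tau> \<subseteq> S \<and> length \<tau> \<le> card (boxed S)})"
    using finite_X finite_S by (intro finite_cartesian_product finite_lists_length_le)
qed

lemma IL_minus_frame_canonical:
  assumes "canonical_worlds \<noteq> {}"
  shows "IL_minus_frame canonical_frame"
proof -
  have sub: "canonical_acc \<subseteq> canonical_worlds \<times> canonical_worlds"
    by (auto simp: canonical_acc_def)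
  have tr: "trans canonical_acc"
    by (rule transI) (force simp: canonical_acc_def intro: succ_trans)
  have "irrefl canonical_acc"
    by (auto simp: irrefl_def canonical_acc_def)
  then have "acyclic canonical_acc"
    using tr by (simp add: acyclic_irrefl)
  moreover have "finite canonical_acc"
    using sub finite_canonical_worlds by (meson finite_SigmaI finite_subset)
  ultimately have "wf (canonical_acc\<inverse>)"
    by (simp add: finite_acyclic_wf_converse)
  moreover have S: "(x, y) \<in> canonical_acc \<and> (x, z) \<in> canonical_acc"
    if "(y, z) \<in> canonical_succ_rel x" for x y z
    using that by (cases x) (auto simp: canonical_succ_rel_def)
  then have "canonical_succ_rel x \<subseteq> canonical_worlds \<times> canonical_worlds" for x
    using sub by (intro subrelI) blast
  ultimately show ?thesis
    using assms sub tr by (simp add: IL_minus_frame_def S)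
qed

text \<open>The boxed negations in a critical set persist to its successors and hold there; the one
  of \<open>C\<close> makes the successor refute \<open>C\<close>.\<close>

lemma succ_critical:
  assumes "critical C \<Gamma> \<Delta>" "succ \<Delta> \<Theta>" "C \<in> S" "\<Theta> \<in> X"
  shows "critical C \<Gamma> \<Theta>" "C \<notin> \<Theta>"
proof -
  have *: "B \<notin> \<Theta>" "(\<^bold>\<box> \<^bold>\<not> B) \<in> \<Theta>" if "B \<in> S" "(\<^bold>\<box> \<^bold>\<not> B) \<in> \<Delta>" for B
    using that assms(2) boxed_intros(2) mcs_X [OF assms(4)] mcs_Neg unfolding succ_def by blast+
  show "critical C \<Gamma> \<Theta>" "C \<notin> \<Theta>"
    using assms(1,3) * unfolding critical_def by blast+
qed

lemma frame_of_canonical: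
  assumes "canonical_worlds \<noteq> {}"
  shows "frame_of canonical_frame (IL_minus {J2_plus, J5})"
proof (rule frame_of_J2_plus_J5)
  show "IL_minus_frame canonical_frame"
    using assms by (rule IL_minus_frame_canonical)
  show "trans (succ_rel canonical_frame x)" for x
    by (rule transI, cases x) (fastforce simp: canonical_succ_rel_def)
  show "(x, z) \<in> acc canonical_frame" if "(y, z) \<in> succ_rel canonical_frame x" for x y z
    using that by (cases x) (auto simp: canonical_succ_rel_def)
  show "(y, z) \<in> succ_rel canonical_frame x"
    if xy: "(x, y) \<in> acc canonical_frame" and yz: "(y, z) \<in> acc canonical_frame" for x y z
  proof -
    \<comment> \<open>The list of \<open>z\<close> extends that of \<open>y\<close>, so relative to
      \<open>x\<close> both carry the same label \<open>C\<close>.\<close>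
    obtain \<Gamma> \<tau> \<Delta> C \<rho> \<Theta> \<rho>' where
      xyz: "x = (\<Gamma>, \<tau>)" "y = (\<Delta>, \<tau> @ C # \<rho>)" "z = (\<Theta>, (\<tau> @ C # \<rho>) @ \<rho>')"
      and "succ \<Delta> \<Theta>" "\<Theta> \<in> X" "C \<in> S"
      using xy yz by (fastforce simp: canonical_acc_def canonical_worlds_def)
    then have "critical C \<Gamma> \<Delta> \<longrightarrow> critical C \<Gamma> \<Theta> \<and> C \<notin> \<Theta>"
      using succ_critical by blast
    moreover have "(x, z) \<in> canonical_acc"
      using transD [of canonical_acc x y z] xy yz IL_minus_frame_canonical [OF assms]
      by (auto simp: IL_minus_frame_def)
    ultimately show ?thesis
      using xy by (auto simp: canonical_succ_rel_def xyz)
  qed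
qed

lemma frame_of_canonical_IL:
  assumes "canonical_worlds \<noteq> {}" "\<And>A. A \<in> J1 \<Longrightarrow> L \<turnstile> A"
  shows "frame_of canonical_frame IL"
proof (rule frame_of_IL [OF frame_of_canonical [OF assms(1)]])
  have refl: "(C \<^bold>\<rhd> C) \<in> \<Gamma>" if "\<Gamma> \<in> X" for \<Gamma> C
  proof -
    have "L \<turnstile> (\<^bold>\<box> (C \<^bold>\<rightarrow> C))"
      by (rule necessitation, rule derivable_taut) (simp add: tautology_def)
    moreover have "L \<turnstile> (\<^bold>\<box> (C \<^bold>\<rightarrow> C) \<^bold>\<rightarrow> (C \<^bold>\<rhd> C))"
      using assms(2) by (auto simp: J1_def)
    ultimately show ?thesis
      using mcs_X [OF that] mcs_derivable modus_ponens by blast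
  qed
  show "(y, y) \<in> succ_rel canonical_frame x" if xy: "(x, y) \<in> acc canonical_frame" for x y
  proof -
    obtain \<Gamma> \<tau> \<Delta> C \<rho> where xy': "x = (\<Gamma>, \<tau>)" "y = (\<Delta>, \<tau> @ C # \<rho>)" and "\<Gamma> \<in> X" "C \<in> S"
      using xy by (fastforce simp: canonical_acc_def canonical_worlds_def)
    \<comment> \<open>Criticality excludes every \<open>B\<close> in \<open>S\<close> with
      \<open>B \<rhd> C\<close> in \<open>\<Gamma>\<close>; here \<open>B\<close> is
      \<open>C\<close> itself.\<close>
    then have "critical C \<Gamma> \<Delta> \<longrightarrow> C \<notin> \<Delta>"
      using refl by (auto simp: critical_def)
    then show ?thesis
      using xy by (auto simp: canonical_succ_rel_def xy')
  qed
qed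

section \<open>The truth lemma\<close>

lemma canonical_acc_append:
  assumes "(\<Gamma>, \<tau>) \<in> canonical_worlds" "\<Delta> \<in> X" "succ \<Gamma> \<Delta>" "C \<in> S"
  shows "((\<Gamma>, \<tau>), (\<Delta>, \<tau> @ [C])) \<in> canonical_acc"
  using assms depth_less [OF assms(3)] by (auto simp: canonical_acc_def canonical_worlds_def)

definition canonical_valuation :: "world \<Rightarrow> nat \<Rightarrow> bool" where
  "canonical_valuation = (\<lambda>(\<Gamma>, \<tau>) p. Var p \<in> \<Gamma>)"

abbreviation canonical_sat :: "world \<Rightarrow> formula \<Rightarrow> bool" where
  "canonical_sat \<equiv> sat canonical_frame canonical_valuation"

lemma truth_Box:
  assumes w: "(\<Gamma>, \<tau>) \<in> canonical_worlds" and "A \<in> S"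
    and IH: "\<And>\<Delta> \<sigma>. (\<Delta>, \<sigma>) \<in> canonical_worlds \<Longrightarrow> canonical_sat (\<Delta>, \<sigma>) A \<longleftrightarrow> A \<in> \<Delta>"
  shows "canonical_sat (\<Gamma>, \<tau>) (\<^bold>\<box> A) \<longleftrightarrow> (\<^bold>\<box> A) \<in> \<Gamma>"
proof
  assume "(\<^bold>\<box> A) \<in> \<Gamma>"
  then show "canonical_sat (\<Gamma>, \<tau>) (\<^bold>\<box> A)"
    using boxed_intros(1) [OF \<open>A \<in> S\<close>] IH by (auto simp: canonical_acc_def succ_def)
next
  assume sat: "canonical_sat (\<Gamma>, \<tau>) (\<^bold>\<box> A)"
  show "(\<^bold>\<box> A) \<in> \<Gamma>"
  proof (rule ccontr)
    assume "(\<^bold>\<box> A) \<notin> \<Gamma>"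
    have "\<Gamma> \<in> X"
      using w by (simp add: canonical_worlds_def)
    then have "((\<^bold>\<not> A) \<^bold>\<rhd> \<^bold>\<bottom>) \<notin> \<Gamma>"
      using \<open>(\<^bold>\<box> A) \<notin> \<Gamma>\<close> mcs_J6 mcs_X by blast
    then obtain \<Delta> where \<Delta>: "\<Delta> \<in> X" "(\<^bold>\<not> A) \<in> \<Delta>" "succ \<Gamma> \<Delta>"
      using critical_successor_in_X [OF \<open>\<Gamma> \<in> X\<close>] boxed_intros(3) [OF \<open>A \<in> S\<close>] by blast
    \<comment> \<open>A witness against a box need not be critical, so any member of
      \<open>S\<close> can serve as label, for instance \<open>A\<close>.\<close>
    have acc: "((\<Gamma>, \<tau>), (\<Delta>, \<tau> @ [A])) \<in> canonical_acc"
      using canonical_acc_append w \<Delta> \<open>A \<in> S\<close> by blast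
    then have "A \<in> \<Delta>"
      using sat IH by (auto simp: canonical_acc_def)
    then show False
      using \<Delta> mcs_X by simp
  qed
qed

lemma truth_Rhd:
  assumes w: "(\<Gamma>, \<tau>) \<in> canonical_worlds" and "A \<in> S" "B \<in> S"
    and IHA: "\<And>\<Delta> \<sigma>. (\<Delta>, \<sigma>) \<in> canonical_worlds \<Longrightarrow> canonical_sat (\<Delta>, \<sigma>) A \<longleftrightarrow> A \<in> \<Delta>"
    and IHB: "\<And>\<Delta> \<sigma>. (\<Delta>, \<sigma>) \<in> canonical_worlds \<Longrightarrow> canonical_sat (\<Delta>, \<sigma>) B \<longleftrightarrow> B \<in> \<Delta>"
  shows "canonical_sat (\<Gamma>, \<tau>) (A \<^bold>\<rhd> B) \<longleftrightarrow> (A \<^bold>\<rhd> B) \<in> \<Gamma>"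
proof
  have "\<Gamma> \<in> X"
    using w by (simp add: canonical_worlds_def)
  then have "mcs \<Gamma>"
    by (rule mcs_X)
  {
    assume sat: "canonical_sat (\<Gamma>, \<tau>) (A \<^bold>\<rhd> B)"
    show "(A \<^bold>\<rhd> B) \<in> \<Gamma>"
    proof (rule ccontr)
      assume "(A \<^bold>\<rhd> B) \<notin> \<Gamma>"
      then obtain \<Delta> where \<Delta>: "\<Delta> \<in> X" "A \<in> \<Delta>" "succ \<Gamma> \<Delta>" "critical B \<Gamma> \<Delta>"
        using critical_successor_in_X [OF \<open>\<Gamma> \<in> X\<close>] boxed_intros(2) assms(2,3) by blast
      \<comment> \<open>With label \<open>B\<close>, every \<open>S\<close>-successor of this
        critical world has to refute \<open>B\<close>.\<close>
      have acc: "((\<Gamma>, \<tau>), (\<Delta>, \<tau> @ [B])) \<in> canonical_acc"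
        using canonical_acc_append w \<Delta> assms(3) by blast
      then have "canonical_sat (\<Delta>, \<tau> @ [B]) A"
        using IHA \<Delta>(2) by (auto simp: canonical_acc_def)
      then obtain \<Theta> \<sigma> where "((\<Delta>, \<tau> @ [B]), (\<Theta>, \<sigma>)) \<in> canonical_succ_rel (\<Gamma>, \<tau>)"
          "canonical_sat (\<Theta>, \<sigma>) B"
        using sat acc by fastforce
      then show False
        using IHB \<Delta>(4) by (auto simp: canonical_succ_rel_def canonical_acc_def)
    qed
  }
  {
    assume Rhd: "(A \<^bold>\<rhd> B) \<in> \<Gamma>"
    have "\<exists>v. (u, v) \<in> canonical_succ_rel (\<Gamma>, \<tau>) \<and> canonical_sat v B"
      if acc: "((\<Gamma>, \<tau>), u) \<in> canonical_acc" and sat: "canonical_sat u A" for u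
    proof -
      obtain \<Delta> C \<rho> where u: "u = (\<Delta>, \<tau> @ C # \<rho>)"
          and \<Delta>: "u \<in> canonical_worlds" "\<Delta> \<in> X" "succ \<Gamma> \<Delta>" "C \<in> S"
        using acc by (fastforce simp: canonical_acc_def canonical_worlds_def)
      have "A \<in> \<Delta>"
        using sat IHA \<Delta>(1) u by blast
      \<comment> \<open>The required \<open>S\<close>-successor must keep the label \<open>C\<close>
        of \<open>u\<close>, whichever label that is.\<close>
      have "\<exists>\<Theta>\<in>X. B \<in> \<Theta> \<and> succ \<Gamma> \<Theta> \<and> (critical C \<Gamma> \<Delta> \<longrightarrow> critical C \<Gamma> \<Theta> \<and> C \<notin> \<Theta>)"
      proof (cases "critical C \<Gamma> \<Delta>")
        case True
        have "(A \<^bold>\<rhd> C) \<notin> \<Gamma>"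
          using True \<open>A \<in> \<Delta>\<close> \<open>A \<in> S\<close> by (auto simp: critical_def)
        \<comment> \<open>Splitting \<open>B\<close> by \<open>C\<close> brings
          \<open>A \<rhd> B\<close> into the form of the first conjunct of \<open>J2_plus\<close>;
          its second conjunct must then fail, since \<open>A \<rhd> C\<close> does.\<close>
        moreover have "L \<turnstile> (B \<^bold>\<rightarrow> ((B \<^bold>\<and> \<^bold>\<not> C) \<^bold>\<or> C))"
          by (auto intro: derivable_taut simp: tautology_def)
        then have "(A \<^bold>\<rhd> ((B \<^bold>\<and> \<^bold>\<not> C) \<^bold>\<or> C)) \<in> \<Gamma>"
          using Rhd \<open>mcs \<Gamma>\<close> mcs_R1 by blast
        ultimately have "((B \<^bold>\<and> \<^bold>\<not> C) \<^bold>\<rhd> C) \<notin> \<Gamma>"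
          using \<open>mcs \<Gamma>\<close> mcs_J2_plus by blast
        then obtain \<Theta> where "\<Theta> \<in> X" "(B \<^bold>\<and> \<^bold>\<not> C) \<in> \<Theta>" "succ \<Gamma> \<Theta>" "critical C \<Gamma> \<Theta>"
          using critical_successor_in_X [OF \<open>\<Gamma> \<in> X\<close>] boxed_intros(4) \<open>B \<in> S\<close> \<Delta>(4) by blast
        then show ?thesis
          using mcs_X by auto
      next
        case False
        \<comment> \<open>Any successor satisfying \<open>B\<close> is enough here. If there were
          none, \<open>A \<rhd> \<bottom>\<close> would follow, and by \<open>J6\<close> no
          successor could contain \<open>A\<close>.\<close>
        have "(B \<^bold>\<rhd> \<^bold>\<bottom>) \<notin> \<Gamma>"
        proof
          assume "(B \<^bold>\<rhd> \<^bold>\<bottom>) \<in> \<Gamma>"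
          then have "(A \<^bold>\<rhd> \<^bold>\<bottom>) \<in> \<Gamma>"
            using Rhd \<open>mcs \<Gamma>\<close> mcs_J2 by blast
          moreover have "L \<turnstile> ((\<^bold>\<not> \<^bold>\<not> A) \<^bold>\<rightarrow> A)"
            by (auto intro: derivable_taut simp: tautology_def)
          ultimately have "(\<^bold>\<box> \<^bold>\<not> A) \<in> \<Gamma>"
            using \<open>mcs \<Gamma>\<close> mcs_R2 mcs_J6 by blast
          then have "(\<^bold>\<not> A) \<in> \<Delta>"
            using \<Delta>(3) boxed_intros(2) [OF \<open>A \<in> S\<close>] by (auto simp: succ_def)
          then show False
            using \<open>A \<in> \<Delta>\<close> \<Delta>(2) mcs_X by simp
        qed
        then show ?thesis
          using False critical_successor_in_X [OF \<open>\<Gamma> \<in> X\<close>] boxed_intros(2) [OF \<open>B \<in> S\<close>] by blast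
      qed
      then obtain \<Theta> where \<Theta>: "\<Theta> \<in> X" "B \<in> \<Theta>" "succ \<Gamma> \<Theta>"
          "critical C \<Gamma> \<Delta> \<longrightarrow> critical C \<Gamma> \<Theta> \<and> C \<notin> \<Theta>"
        by blast
      have acc': "((\<Gamma>, \<tau>), (\<Theta>, \<tau> @ [C])) \<in> canonical_acc"
        using canonical_acc_append w \<Theta> \<Delta>(4) by blast
      then have "(u, (\<Theta>, \<tau> @ [C])) \<in> canonical_succ_rel (\<Gamma>, \<tau>)"
        using acc \<Theta>(4) by (auto simp: canonical_succ_rel_def u)
      moreover have "canonical_sat (\<Theta>, \<tau> @ [C]) B"
        using IHB \<Theta>(2) acc' by (auto simp: canonical_acc_def)
      ultimately show ?thesis
        by blast
    qed
    then show "canonical_sat (\<Gamma>, \<tau>) (A \<^bold>\<rhd> B)"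
      by (simp del: split_paired_All split_paired_Ex)
  }
qed

end

primrec subformulas :: "formula \<Rightarrow> formula set" where
  "subformulas (Var p) = {Var p}"
| "subformulas \<^bold>\<top> = {\<^bold>\<top>}"
| "subformulas \<^bold>\<bottom> = {\<^bold>\<bottom>}"
| "subformulas (\<^bold>\<not> A) = insert (\<^bold>\<not> A) (subformulas A)"
| "subformulas (A \<^bold>\<and> B) = insert (A \<^bold>\<and> B) (subformulas A \<union> subformulas B)"
| "subformulas (A \<^bold>\<or> B) = insert (A \<^bold>\<or> B) (subformulas A \<union> subformulas B)"
| "subformulas (A \<^bold>\<rightarrow> B) = insert (A \<^bold>\<rightarrow> B) (subformulas A \<union> subformulas B)"
| "subformulas (\<^bold>\<box> A) = insert (\<^bold>\<box> A) (subformulas A)"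
| "subformulas (A \<^bold>\<rhd> B) = insert (A \<^bold>\<rhd> B) (subformulas A \<union> subformulas B)"

lemma finite_subformulas: "finite (subformulas A)"
  by (induction A) auto

lemma subformulas_refl: "A \<in> subformulas A"
  by (cases A) auto

lemma (in canonical) truth:
  assumes "(\<Gamma>, \<tau>) \<in> canonical_worlds" "subformulas A \<subseteq> S"
  shows "canonical_sat (\<Gamma>, \<tau>) A \<longleftrightarrow> A \<in> \<Gamma>"
proof -
  have mcs: "mcs \<Gamma>" if "(\<Gamma>, \<tau>) \<in> canonical_worlds" for \<Gamma> \<tau>
    using that mcs_X by (simp add: canonical_worlds_def)
  show ?thesis
    using assms
  proof (induction A arbitrary: \<Gamma> \<tau>)
    case (Box A)
    then show ?case
      using subformulas_refl by (intro truth_Box) auto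
  next
    case (Rhd A B)
    then show ?case
      using subformulas_refl [of A] subformulas_refl [of B] by (intro truth_Rhd) auto
  qed (use mcs in \<open>simp_all add: canonical_valuation_def\<close>)
qed

section \<open>Completeness\<close>

lemma (in interpretability_logic) finite_countermodel:
  assumes "\<not> L \<turnstile> A"
  shows "\<exists>F :: (formula set \<times> formula list) frame.
    finite (worlds F) \<and> frame_of F (IL_minus {J2_plus, J5}) \<and>
    ((\<forall>B\<in>J1. L \<turnstile> B) \<longrightarrow> frame_of F IL) \<and> \<not> valid F A"
proof -
  define S where "S = subformulas A"
  define T where "T = boxed S \<union> Box ` boxed S"
  have "finite S"
    by (simp add: S_def finite_subformulas)
  then have "finite (Pow T)"
    by (simp add: T_def finite_boxed)
  then have "finite ((\<lambda>M. M \<inter> T) ` Collect mcs)"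
    by (rule finite_subset [rotated]) auto
  \<comment> \<open>There are finitely many traces on the finite set \<open>T\<close>;
    \<open>X\<close> collects finitely many maximal consistent sets realising all of them.\<close>
  from finite_subset_image [OF this order_refl]
  obtain X where X: "X \<subseteq> Collect mcs" "finite X"
      "(\<lambda>M. M \<inter> T) ` Collect mcs = (\<lambda>M. M \<inter> T) ` X"
    by (elim exE conjE)
  have rep: "\<exists>\<Gamma>\<in>X. \<Gamma> \<inter> T = M \<inter> T" if "mcs M" for M
  proof -
    have "M \<inter> T \<in> (\<lambda>M. M \<inter> T) ` X"
      unfolding X(3) [symmetric] using that by simp
    then show ?thesis
      by (auto elim!: imageE)
  qed
  interpret canonical L S X
    using X(1,2) \<open>finite S\<close> rep by unfold_locales (auto simp: T_def)
  obtain M where M: "mcs M" "A \<notin> M"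
    using assms derivable_if_mcs by blast
  then obtain \<Gamma> where \<Gamma>: "\<Gamma> \<in> X" "\<Gamma> \<inter> T = M \<inter> T"
    using rep by blast
  have "A \<in> T"
    by (simp add: T_def S_def boxed_intros(1) subformulas_refl)
  then have "A \<notin> \<Gamma>"
    using M(2) \<Gamma>(2) by blast
  \<comment> \<open>The empty list respects the length bound at any depth, so
    \<open>(\<Gamma>, [])\<close> can refute \<open>A\<close>.\<close>
  have w: "(\<Gamma>, []) \<in> canonical_worlds"
    using \<Gamma>(1) by (simp add: canonical_worlds_def)
  then have "\<not> canonical_sat (\<Gamma>, []) A"
    using truth [of \<Gamma> "[]" A] \<open>A \<notin> \<Gamma>\<close> by (simp add: S_def)
  then have "\<not> valid canonical_frame A"
    using w by (auto simp: valid_def)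
  then show ?thesis
    using w finite_canonical_worlds frame_of_canonical frame_of_canonical_IL
    by (intro exI [of _ canonical_frame]) auto
qed

text \<open>\<open>J1\<close> gives \<open>D \<rhd> D\<close>, \<open>J3\<close> joins it with
  \<open>C \<rhd> D\<close>, and \<open>J2\<close> composes the result with the first
  conjunct.\<close>

lemma IL_derives_J2_plus:
  assumes "A \<in> J2_plus"
  shows "IL \<turnstile> A"
proof -
  obtain B C D where A: "A = (((B \<^bold>\<rhd> (C \<^bold>\<or> D)) \<^bold>\<and> (C \<^bold>\<rhd> D)) \<^bold>\<rightarrow> (B \<^bold>\<rhd> D))"
    using assms by (auto simp: J2_plus_def)
  let ?E = "C \<^bold>\<or> D"
  have mem: "Taut \<subseteq> IL" "J1 \<subseteq> IL" "J2 \<subseteq> IL" "J3 \<subseteq> IL"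
    by (auto simp: IL_def IL_minus_def)
  have "IL \<turnstile> (\<^bold>\<box> (D \<^bold>\<rightarrow> D))"
    by (rule necessitation, rule axiom) (use mem(1) in \<open>auto simp: Taut_def tautology_def\<close>)
  moreover have "IL \<turnstile> (\<^bold>\<box> (D \<^bold>\<rightarrow> D) \<^bold>\<rightarrow> (D \<^bold>\<rhd> D))"
    using mem(2) by (auto intro!: axiom simp: J1_def)
  ultimately have refl: "IL \<turnstile> (D \<^bold>\<rhd> D)"
    by (rule modus_ponens [rotated])
  have join: "IL \<turnstile> (((C \<^bold>\<rhd> D) \<^bold>\<and> (D \<^bold>\<rhd> D)) \<^bold>\<rightarrow> (?E \<^bold>\<rhd> D))"
    using mem(4) by (auto intro!: axiom simp: J3_def)
  have trans: "IL \<turnstile> (((B \<^bold>\<rhd> ?E) \<^bold>\<and> (?E \<^bold>\<rhd> D)) \<^bold>\<rightarrow> (B \<^bold>\<rhd> D))"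
    using mem(3) by (auto intro!: axiom simp: J2_def)
  have "IL \<turnstile> ((D \<^bold>\<rhd> D) \<^bold>\<rightarrow> (((C \<^bold>\<rhd> D) \<^bold>\<and> (D \<^bold>\<rhd> D)) \<^bold>\<rightarrow> (?E \<^bold>\<rhd> D)) \<^bold>\<rightarrow>
      (((B \<^bold>\<rhd> ?E) \<^bold>\<and> (?E \<^bold>\<rhd> D)) \<^bold>\<rightarrow> (B \<^bold>\<rhd> D)) \<^bold>\<rightarrow> A)"
    using mem(1) by (auto intro!: axiom simp: Taut_def tautology_def A)
  from modus_ponens [OF modus_ponens [OF modus_ponens [OF this refl] join] trans]
  show ?thesis .
qed

lemma completeness:
  assumes "L = IL_minus {J2_plus, J5} \<or> L = IL" "infinite (UNIV :: 'w set)" "\<not> L \<turnstile> A"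
  shows "\<exists>F :: 'w frame. frame_of F L \<and> finite (worlds F) \<and> \<not> valid F A"
proof -
  interpret interpretability_logic L
  proof
    show "L \<turnstile> B" if "B \<in> IL_minus {J2_plus, J5}" for B
    \<comment> \<open>Only the instances of \<open>J2_plus\<close> can fail to be axioms, and only
      when \<open>L\<close> is \<open>IL\<close>.\<close>
    proof (cases "L = IL \<and> B \<in> J2_plus")
      case True
      then show ?thesis
        using IL_derives_J2_plus by blast
    next
      case False
      then have "B \<in> L"
        using that assms(1) by (auto simp: IL_def IL_minus_def)
      then show ?thesis
        by (rule axiom)
    qed
  qed
  obtain F :: "(formula set \<times> formula list) frame" where
    F: "finite (worlds F)" "frame_of F (IL_minus {J2_plus, J5})"
      "(\<forall>B\<in>J1. L \<turnstile> B) \<longrightarrow> frame_of F IL" "\<not> valid F A"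
    using finite_countermodel [OF assms(3)] by blast
  have "frame_of F L"
    using assms(1)
  proof
    assume "L = IL"
    then have "\<forall>B\<in>J1. L \<turnstile> B"
      by (auto intro!: axiom simp: IL_def IL_minus_def)
    then show ?thesis
      using F(3) \<open>L = IL\<close> by blast
  qed (use F(2) in simp)
  then show ?thesis
    using transfer_finite_frame assms(2) F(1,4) by blast
qed

(* Frames are carried by subsets of the type 'w, which is an arbitrary infinite type, so that
   frames of every size occur for a suitable 'w, and all finite frames occur, up to
   isomorphism, for every 'w. For a finite 'w the completeness direction would only see
   frames of bounded size. *)
theorem theorem5p2:
  fixes L :: "formula set" and A :: formula
  assumes "L = IL_minus {J2_plus, J5} \<or> L = IL"
    and "infinite (UNIV :: 'w set)"
  shows "(L \<turnstile> A \<longleftrightarrow> (\<forall>F :: 'w frame. frame_of F L \<longrightarrow> valid F A)) \<and>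
         (L \<turnstile> A \<longleftrightarrow> (\<forall>F :: 'w frame. frame_of F L \<and> finite (worlds F) \<longrightarrow> valid F A))"
  using soundness completeness [OF assms] by blast

end
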